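(* Let $X$ be a locally convex topological vector space, let $f\colon X\to(-\infty,\infty]$ be a proper convex function, and let $g\colon X\to[-\infty,\infty)$ be a proper concave function such that there exists $\hat{x}\in X$ satisfying $\inf\{f(x)-g(x)\mid x\in X\}=f(\hat{x})-g(\hat{x})$. Suppose that the following conditions are satisfied simultaneously: (a) $\mathrm{qri}(\mathrm{dom}(f))\cap\mathrm{qri}(\mathrm{dom}(g))\neq\emptyset$; (b) all the convex sets $\mathrm{dom}(f)-\mathrm{dom}(g)$, $\mathrm{epi}(f)$, and $\mathrm{epi}(f)-\mathrm{hypo}(g)$ are quasi-regular. Then $$\inf\{f(x)-g(x)\mid x\in X\}=\sup\{g_*(x^* )-f^*(x^* )\mid x^*\in X^*\}.$$
   Context: All spaces are real Hausdorff topological vector spaces; $X^*$ is the topological dual of $X$ and $\langle x^*,x\rangle:=x^*(x)$. For sets $A,B$ in a vector space, $A-B:=\{a-b\mid a\in A,\ b\in B\}$. For a nonempty subset $S$ of a topological vector space, $\mathrm{cone}(S):=\{tw\mid t\ge 0,\ w\in S\}$ and $\overline{\mathrm{cone}}(S)$ is its closure. For a convex subset $\Omega$ of a topological vector space $Z$: the intrinsic relative interior is $\mathrm{iri}(\Omega):=\{x\in\Omega\mid \mathrm{cone}(\Omega-x)\text{ is a linear subspace of }Z\}$; the quasi-relative interior is $\mathrm{qri}(\Omega):=\{x\in\Omega\mid \overline{\mathrm{cone}}(\Omega-x)\text{ is a linear subspace of }Z\}$; $\Omega$ is called quasi-regular if $\mathrm{qri}(\Omega)=\mathrm{iri}(\Omega)$.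 For $f\colon X\to(-\infty,\infty]$: $\mathrm{dom}(f):=\{x\in X\mid f(x)<\infty\}$, $\mathrm{epi}(f):=\{(x,\alpha)\in X\times\mathbb{R}\mid \alpha\ge f(x)\}$; $f$ is convex if $\mathrm{epi}(f)$ is convex and proper if $\mathrm{dom}(f)\ne\emptyset$. For $g\colon X\to[-\infty,\infty)$: $g$ is concave (proper) if $-g$ is convex (proper), $\mathrm{dom}(g):=\{x\in X\mid g(x)>-\infty\}$, $\mathrm{hypo}(g):=\{(x,\alpha)\in X\times\mathbb{R}\mid \alpha\le g(x)\}$. The convex Fenchel conjugate of $f$ is $f^*(x^* ):=\sup\{\langle x^*,x\rangle-f(x)\mid x\in X\}$, and the concave Fenchel conjugate of $g$ is $g_*(x^* ):=\inf\{\langle x^*,x\rangle-g(x)\mid x\in X\}$, for $x^*\in X^*$. *)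

theory Defs
  imports "HOL-Analysis.Analysis"
begin

section \<open>Locally convex topological vector spaces\<close>

text \<open>Joint continuity of scalar multiplication is stated with filters, in the style of
  the library class \<open>topological_monoid_add\<close>. The Hausdorff property is part of the class.
  In \<open>locally_convex_tvs\<close> the convexity of the neighbourhood \<open>V\<close> is unfolded, because
  \<open>convex\<close> cannot be used inside a class specification.\<close>

class real_tvs = real_vector + topological_ab_group_add + t2_space +
  assumes tendsto_scaleR_Pair:
    "LIM p (nhds c \<times>\<^sub>F nhds x). fst p *\<^sub>R snd p :> nhds (c *\<^sub>R x)"

class locally_convex_tvs = real_tvs +
  assumes locally_convex:
    "open U \<Longrightarrow> x \<in> U \<Longrightarrow> \<exists>V. open V \<and>
      (\<forall>a\<in>V. \<forall>b\<in>V. \<forall>u\<ge>0. \<forall>v\<ge>0. u + v = 1 \<longrightarrow> u *\<^sub>R a + v *\<^sub>R b \<in> V) \<and> x \<in> V \<and> V \<subseteq> U"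

lemma locally_convex_neighbourhood:
  fixes x :: "'a::locally_convex_tvs"
  assumes "open U" "x \<in> U"
  shows "\<exists>V. open V \<and> convex V \<and> x \<in> V \<and> V \<subseteq> U"
  using locally_convex[OF assms] unfolding convex_def .

instance real_normed_vector \<subseteq> locally_convex_tvs
proof
  fix c :: real and x :: 'a
  show "LIM p (nhds c \<times>\<^sub>F nhds x). fst p *\<^sub>R snd p :> nhds (c *\<^sub>R x)"
    by (intro tendsto_scaleR filterlim_fst filterlim_snd)
next
  fix U :: "'a set" and x :: 'a
  assume "open U" "x \<in> U"
  then obtain e where "e > 0" "ball x e \<subseteq> U"
    using open_contains_ball by blast
  then have "\<exists>V. open V \<and> convex V \<and> x \<in> V \<and> V \<subseteq> U"
    by (intro exI[of _ "ball x e"]) auto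
  then show "\<exists>V. open V \<and>
      (\<forall>a\<in>V. \<forall>b\<in>V. \<forall>u\<ge>0. \<forall>v\<ge>0. u + v = 1 \<longrightarrow> u *\<^sub>R a + v *\<^sub>R b \<in> V) \<and> x \<in> V \<and> V \<subseteq> U"
    unfolding convex_def .
qed

definition topological_dual :: "('a::{real_vector,topological_space} \<Rightarrow> real) set" where
  "topological_dual = {\<phi>. linear \<phi> \<and> continuous_on UNIV \<phi>}"

section \<open>Generalized relative interiors\<close>

text \<open>The library operator \<open>-\<close> on sets is the set difference, and the library constant
  \<open>cone\<close> is the predicate of being a cone; hence the separate names below.\<close>

definition minkowski_diff :: "'a::ab_group_add set \<Rightarrow> 'a set \<Rightarrow> 'a set" where
  "minkowski_diff A B = {a - b | a b. a \<in> A \<and> b \<in> B}"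

definition cone_generated :: "'a::real_vector set \<Rightarrow> 'a set" where
  "cone_generated S = {t *\<^sub>R w | t w. t \<ge> 0 \<and> w \<in> S}"

definition iri :: "'a::real_vector set \<Rightarrow> 'a set" where
  "iri \<Omega> = {x \<in> \<Omega>. subspace (cone_generated (minkowski_diff \<Omega> {x}))}"

definition qri :: "'a::{real_vector,topological_space} set \<Rightarrow> 'a set" where
  "qri \<Omega> = {x \<in> \<Omega>. subspace (closure (cone_generated (minkowski_diff \<Omega> {x})))}"

definition quasi_regular :: "'a::{real_vector,topological_space} set \<Rightarrow> bool" where
  "quasi_regular \<Omega> \<longleftrightarrow> qri \<Omega> = iri \<Omega>"

section \<open>Extended-real-valued convex and concave functions\<close>

definition dom_convex :: "('a \<Rightarrow> ereal) \<Rightarrow> 'a set" where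
  "dom_convex f = {x. f x < \<infinity>}"

definition dom_concave :: "('a \<Rightarrow> ereal) \<Rightarrow> 'a set" where
  "dom_concave g = {x. g x > - \<infinity>}"

definition epi :: "('a \<Rightarrow> ereal) \<Rightarrow> ('a \<times> real) set" where
  "epi f = {(x, \<alpha>). ereal \<alpha> \<ge> f x}"

definition hypo :: "('a \<Rightarrow> ereal) \<Rightarrow> ('a \<times> real) set" where
  "hypo g = {(x, \<alpha>). ereal \<alpha> \<le> g x}"

text \<open>The predicates \<open>proper_convex\<close> and \<open>proper_concave\<close> include the restriction of the
  codomain to \<open>(-\<infinity>, \<infinity>]\<close> and \<open>[-\<infinity>, \<infinity>)\<close>, respectively.\<close>

definition proper_convex :: "('a::real_vector \<Rightarrow> ereal) \<Rightarrow> bool" where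
  "proper_convex f \<longleftrightarrow> (\<forall>x. f x \<noteq> - \<infinity>) \<and> convex (epi f) \<and> dom_convex f \<noteq> {}"

definition proper_concave :: "('a::real_vector \<Rightarrow> ereal) \<Rightarrow> bool" where
  "proper_concave g \<longleftrightarrow> proper_convex (\<lambda>x. - g x)"

text \<open>For \<open>f\<close> with values in \<open>(-\<infinity>, \<infinity>]\<close> and \<open>g\<close> with values in \<open>[-\<infinity>, \<infinity>)\<close>, the
  \<open>ereal\<close> subtractions below never have two equal infinite arguments.\<close>

definition convex_conjugate ::
  "('a::{real_vector,topological_space} \<Rightarrow> ereal) \<Rightarrow> ('a \<Rightarrow> real) \<Rightarrow> ereal" where
  "convex_conjugate f \<phi> = (SUP x. ereal (\<phi> x) - f x)"

definition concave_conjugate ::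
  "('a::{real_vector,topological_space} \<Rightarrow> ereal) \<Rightarrow> ('a \<Rightarrow> real) \<Rightarrow> ereal" where
  "concave_conjugate g \<phi> = (INF x. ereal (\<phi> x) - g x)"

end

theory Submission
  imports Defs
begin

text \<open>
  Weak duality is the pointwise estimate
  \<open>g\<^sub>*(\<phi>) - f\<^sup>*(\<phi>) \<le> (\<phi> x - g x) - (\<phi> x - f x)\<close>. The converse asks for a dual element that attains the
  value \<open>m\<close> of the infimum, that is, for an affine function \<open>\<phi> + c\<close> that fits between \<open>g\<close> and
  \<open>f - m\<close>.

  Put \<open>M = epi f - hypo g\<close>. Since the infimum is attained and finite, \<open>(0, m)\<close> is a point of \<open>M\<close>, and
  it is a lowest point of \<open>M\<close> on the vertical axis. So the cone generated by \<open>M - (0, m)\<close> contains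
  \<open>(0, 1)\<close> but not \<open>(0, -1)\<close>: the point is outside \<open>iri M\<close>
  (\<open>zero_not_in_iri_epi_minus_hypo\<close>), hence outside \<open>qri M\<close> by quasi-regularity. For a convex set,
  being outside the quasi-relative interior yields, by the Hahn--Banach theorem, a continuous linear
  \<open>\<psi>\<close> that attains its minimum over \<open>M\<close> at \<open>(0, m)\<close> without being constant on \<open>M\<close>
  (\<open>supporting_functional_outside_qri\<close>).

  Write \<open>\<psi>(x, a) = \<rho> x + \<gamma> a\<close>. Moving upwards stays in \<open>M\<close>, so \<open>\<gamma> \<ge> 0\<close>. If \<open>\<gamma> = 0\<close>, then every value
  of \<open>\<rho>\<close> on \<open>dom f\<close> is at least every value on \<open>dom g\<close>; at a common point of the two quasi-relative
  interiors \<open>\<rho>\<close> is therefore minimal over \<open>dom f\<close> and maximal over \<open>dom g\<close>, which forces it to be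
  constant on both sets, and \<open>\<psi>\<close> would be constant on \<open>M\<close>
  (\<open>nonvertical_supporting_functional\<close>). So \<open>\<gamma> > 0\<close>, and \<open>\<phi> = - \<rho> / \<gamma>\<close> is the required dual element.

  The Hahn--Banach separation used here is that of a point from the closure of a convex cone in a
  locally convex space. It is derived from the sublinear form of the theorem, which in turn follows
  from the fact that minimal sublinear functionals are linear.
\<close>

section \<open>The Hahn--Banach theorem for sublinear functionals\<close>

definition sublinear :: "('a::real_vector \<Rightarrow> real) \<Rightarrow> bool" where
  "sublinear p \<longleftrightarrow> (\<forall>x y. p (x + y) \<le> p x + p y) \<and> (\<forall>x. \<forall>t>0. p (t *\<^sub>R x) \<le> t * p x)"

lemma sublinearI:
  assumes "\<And>x y. p (x + y) \<le> p x + p y" "\<And>t x. t > 0 \<Longrightarrow> p (t *\<^sub>R x) \<le> t * p x"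
  shows "sublinear p"
  using assms unfolding sublinear_def by blast

lemma sublinear_add: "sublinear p \<Longrightarrow> p (x + y) \<le> p x + p y"
  unfolding sublinear_def by blast

lemma sublinear_scaleR_le: "sublinear p \<Longrightarrow> t > 0 \<Longrightarrow> p (t *\<^sub>R x) \<le> t * p x"
  unfolding sublinear_def by blast

lemma sublinear_zero:
  assumes "sublinear p"
  shows "p 0 = 0"
  using sublinear_add[OF assms, of 0 0] sublinear_scaleR_le[OF assms, of "1/2" 0] by simp

lemma sublinear_scaleR:
  assumes p: "sublinear p" and t: "t \<ge> 0"
  shows "p (t *\<^sub>R x) = t * p x"
proof (cases "t = 0")
  case False
  with t have "t > 0" by simp
  moreover have "p x \<le> (1/t) * p (t *\<^sub>R x)"
    using sublinear_scaleR_le[OF p, of "1/t" "t *\<^sub>R x"] \<open>t > 0\<close> by simp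
  ultimately show ?thesis
    using sublinear_scaleR_le[OF p, of t x] by (intro antisym) (simp_all add: field_simps)
qed (simp add: sublinear_zero[OF p])

lemma sublinear_lower_bound:
  assumes "sublinear p"
  shows "- p (- x) \<le> p x"
  using sublinear_add[OF assms, of x "- x"] sublinear_zero[OF assms] by simp

text \<open>
  The largest sublinear functional \<open>q \<le> p\<close> with \<open>q (- y) \<le> - p y\<close>. A linear functional below \<open>p\<close> agrees
  with \<open>p\<close> at \<open>y\<close> exactly if it lies below \<open>tilt p y\<close>. The same construction also shows that minimal
  sublinear functionals are additive.
\<close>
definition tilt :: "('a::real_vector \<Rightarrow> real) \<Rightarrow> 'a \<Rightarrow> 'a \<Rightarrow> real" where
  "tilt p y x = (INF t\<in>{0..}. p (x + t *\<^sub>R y) - t * p y)"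

lemma tilt_le:
  assumes p: "sublinear p" and "t \<ge> 0"
  shows "tilt p y x \<le> p (x + t *\<^sub>R y) - t * p y"
  unfolding tilt_def
proof (rule cINF_lower)
  have "- p (- x) \<le> p (x + s *\<^sub>R y) - s * p y" if "s \<ge> 0" for s
    using sublinear_add[OF p, of "x + s *\<^sub>R y" "- x"] sublinear_scaleR[OF p that, of y] by simp
  then show "bdd_below ((\<lambda>s. p (x + s *\<^sub>R y) - s * p y) ` {0..})"
    by (intro bdd_belowI2[of _ "- p (- x)"]) simp
qed (use assms in simp)

lemma tilt_greatest:
  assumes "\<And>t. t \<ge> 0 \<Longrightarrow> m \<le> p (x + t *\<^sub>R y) - t * p y"
  shows "m \<le> tilt p y x"
  unfolding tilt_def by (rule cINF_greatest) (use assms in auto)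

lemma sublinear_tilt:
  assumes p: "sublinear p"
  shows "sublinear (tilt p y)"
proof (rule sublinearI)
  fix u v
  have "tilt p y (u + v) - (p (v + s *\<^sub>R y) - s * p y) \<le> p (u + t *\<^sub>R y) - t * p y"
    if "t \<ge> 0" "s \<ge> 0" for t s
  proof -
    have "tilt p y (u + v) \<le> p ((u + v) + (t + s) *\<^sub>R y) - (t + s) * p y"
      by (rule tilt_le[OF p]) (use that in simp)
    moreover have "(u + v) + (t + s) *\<^sub>R y = (u + t *\<^sub>R y) + (v + s *\<^sub>R y)"
      by (simp add: algebra_simps)
    ultimately show ?thesis
      using sublinear_add[OF p, of "u + t *\<^sub>R y" "v + s *\<^sub>R y"] by (simp add: algebra_simps)
  qed
  then have "tilt p y (u + v) - (p (v + s *\<^sub>R y) - s * p y) \<le> tilt p y u" if "s \<ge> 0" for s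
    using that by (intro tilt_greatest) blast
  then have "tilt p y (u + v) - tilt p y u \<le> p (v + s *\<^sub>R y) - s * p y" if "s \<ge> 0" for s
    using that by (fastforce simp: algebra_simps)
  then have "tilt p y (u + v) - tilt p y u \<le> tilt p y v"
    by (rule tilt_greatest)
  then show "tilt p y (u + v) \<le> tilt p y u + tilt p y v" by simp
next
  fix t :: real and u assume t: "t > 0"
  have "tilt p y (t *\<^sub>R u) / t \<le> p (u + s *\<^sub>R y) - s * p y" if "s \<ge> 0" for s
  proof -
    have "tilt p y (t *\<^sub>R u) \<le> p (t *\<^sub>R u + (t * s) *\<^sub>R y) - (t * s) * p y"
      by (rule tilt_le[OF p]) (use that t in simp)
    also have "t *\<^sub>R u + (t * s) *\<^sub>R y = t *\<^sub>R (u + s *\<^sub>R y)"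
      by (simp add: scaleR_add_right)
    finally show ?thesis
      using sublinear_scaleR[OF p, of t "u + s *\<^sub>R y"] t by (simp add: field_simps)
  qed
  then have "tilt p y (t *\<^sub>R u) / t \<le> tilt p y u"
    by (rule tilt_greatest)
  then show "tilt p y (t *\<^sub>R u) \<le> t * tilt p y u"
    using t by (simp add: field_simps)
qed

lemma tilt_le_self:
  assumes "sublinear p"
  shows "tilt p y \<le> p"
  using tilt_le[OF assms, of 0] by (auto intro!: le_funI)

text \<open>
  The lower bound \<open>- p (- x)\<close> is common to all sublinear functionals below \<open>p\<close>, so the pointwise
  infimum is a genuine one. Subadditivity survives because two members of the chain can be replaced
  by the smaller of them.
\<close>
lemma sublinear_chain_INF:
  assumes C: "C \<noteq> {}" "\<And>q. q \<in> C \<Longrightarrow> sublinear q" "\<And>q. q \<in> C \<Longrightarrow> q \<le> p"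
    and chain: "\<And>q r. q \<in> C \<Longrightarrow> r \<in> C \<Longrightarrow> q \<le> r \<or> r \<le> q"
  shows "sublinear (\<lambda>x. INF q\<in>C. q x)" and "q \<in> C \<Longrightarrow> (\<lambda>x. INF q\<in>C. q x) \<le> q"
proof -
  have bdd: "bdd_below ((\<lambda>q. q x) ` C)" for x
  proof (rule bdd_belowI2)
    fix q assume "q \<in> C"
    then show "- p (- x) \<le> q x"
      using sublinear_lower_bound[OF C(2), of q x] le_funD[OF C(3), of q "- x"] by simp
  qed
  have lower: "(INF q\<in>C. q x) \<le> q x" if "q \<in> C" for q x
    using that by (rule cINF_lower[OF bdd])
  then show "q \<in> C \<Longrightarrow> (\<lambda>x. INF q\<in>C. q x) \<le> q"
    by (simp add: le_fun_def)
  show "sublinear (\<lambda>x. INF q\<in>C. q x)"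
  proof (rule sublinearI)
    fix x y
    have "(INF q\<in>C. q (x + y)) \<le> q x + r y" if qr: "q \<in> C" "r \<in> C" for q r
    proof -
      obtain s where s: "s \<in> C" "s \<le> q" "s \<le> r"
        using chain[OF qr] qr by blast
      have "(INF q\<in>C. q (x + y)) \<le> s x + s y"
        using lower[OF s(1), of "x + y"] sublinear_add[OF C(2)[OF s(1)], of x y] by simp
      then show ?thesis
        using le_funD[OF s(2), of x] le_funD[OF s(3), of y] by simp
    qed
    then have "(INF q\<in>C. q (x + y)) - q x \<le> r y" if "q \<in> C" "r \<in> C" for q r
      using that by (simp add: diff_le_eq add.commute)
    then have "(INF q\<in>C. q (x + y)) - q x \<le> (INF r\<in>C. r y)" if "q \<in> C" for q
      using that C(1) by (intro cINF_greatest)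
    then have "(INF q\<in>C. q (x + y)) - (INF r\<in>C. r y) \<le> q x" if "q \<in> C" for q
      using that by (simp add: diff_le_eq add.commute)
    then have "(INF q\<in>C. q (x + y)) - (INF r\<in>C. r y) \<le> (INF q\<in>C. q x)"
      using C(1) by (intro cINF_greatest)
    then show "(INF q\<in>C. q (x + y)) \<le> (INF q\<in>C. q x) + (INF q\<in>C. q y)" by simp
  next
    fix t :: real and x assume t: "t > 0"
    have "(INF q\<in>C. q (t *\<^sub>R x)) / t \<le> q x" if "q \<in> C" for q
      using lower[OF that, of "t *\<^sub>R x"] sublinear_scaleR_le[OF C(2)[OF that] t, of x] t
      by (simp add: field_simps)
    then have "(INF q\<in>C. q (t *\<^sub>R x)) / t \<le> (INF q\<in>C. q x)"
      using C(1) by (intro cINF_greatest) auto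
    then show "(INF q\<in>C. q (t *\<^sub>R x)) \<le> t * (INF q\<in>C. q x)"
      using t by (simp add: field_simps)
  qed
qed

lemma minimal_sublinear_exists:
  assumes p: "sublinear p"
  obtains q where "sublinear q" "q \<le> p" "\<And>r. sublinear r \<Longrightarrow> r \<le> q \<Longrightarrow> r = q"
proof -
  define A where "A = {q. sublinear q \<and> q \<le> p}"
  have "\<exists>m\<in>A. \<forall>a\<in>A. a \<le> m \<longrightarrow> a = m"
  proof (rule predicate_Zorn)
    show "partial_order_on A (relation_of (\<lambda>a b. b \<le> a) A)"
      by (rule partial_order_on_relation_ofI) auto
  next
    fix C assume "C \<in> Chains (relation_of (\<lambda>a b. b \<le> a) A)"
    then have CA: "C \<subseteq> A" and chain: "\<And>q r. q \<in> C \<Longrightarrow> r \<in> C \<Longrightarrow> q \<le> r \<or> r \<le> q"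
      unfolding Chains_def relation_of_def by blast+
    show "\<exists>u\<in>A. \<forall>a\<in>C. u \<le> a"
    proof (cases "C = {}")
      case True
      then show ?thesis using p unfolding A_def by auto
    next
      case False
      note inf = sublinear_chain_INF[OF False _ _ chain, of p]
      have sub: "\<And>q. q \<in> C \<Longrightarrow> sublinear q" "\<And>q. q \<in> C \<Longrightarrow> q \<le> p"
        using CA unfolding A_def by auto
      obtain q where "q \<in> C" using False by blast
      with inf sub show ?thesis
        unfolding A_def by (intro bexI[of _ "\<lambda>x. INF q\<in>C. q x"]) (auto intro: order_trans)
    qed
  qed
  then obtain m where "m \<in> A" "\<And>a. a \<in> A \<Longrightarrow> a \<le> m \<Longrightarrow> a = m" by blast
  then show ?thesis
    by (intro that[of m]) (auto simp: A_def intro: order_trans)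
qed

text \<open>
  Minimality gives \<open>tilt q y = q\<close> for every \<open>y\<close>, and the parameter \<open>t = 1\<close> in the infimum that defines
  the tilt then turns subadditivity into additivity.
\<close>
lemma minimal_sublinear_imp_linear:
  assumes q: "sublinear q" and min: "\<And>r. sublinear r \<Longrightarrow> r \<le> q \<Longrightarrow> r = q"
  shows "linear q"
proof -
  have add: "q (x + y) = q x + q y" for x y
  proof -
    have "tilt q y = q"
      using sublinear_tilt[OF q] tilt_le_self[OF q] by (rule min)
    then have "q x \<le> q (x + y) - q y"
      using tilt_le[OF q, of 1 y x] by simp
    then show ?thesis
      using sublinear_add[OF q, of x y] by simp
  qed
  have neg: "q (- x) = - q x" for x
    using add[of x "- x"] sublinear_zero[OF q] by simp
  have "q (c *\<^sub>R x) = c *\<^sub>R q x" for c x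
    using sublinear_scaleR[OF q, of c x] sublinear_scaleR[OF q, of "- c" x] neg[of "c *\<^sub>R x"]
    by (cases "c \<ge> 0") auto
  with add show ?thesis by (rule linearI)
qed

text \<open>
  A minimal sublinear functional below \<open>tilt p y\<close> is linear, and tilting has fixed its value at \<open>y\<close>.
\<close>
theorem Hahn_Banach_sublinear:
  assumes p: "sublinear p"
  obtains \<phi> where "linear \<phi>" "\<phi> \<le> p" "\<phi> y = p y"
proof -
  obtain q where q: "sublinear q" "q \<le> tilt p y" "\<And>r. sublinear r \<Longrightarrow> r \<le> q \<Longrightarrow> r = q"
    using minimal_sublinear_exists[OF sublinear_tilt[OF p, of y]] by metis
  have lin: "linear q"
    using q(1,3) by (rule minimal_sublinear_imp_linear)
  have le: "q \<le> p"
    using q(2) tilt_le_self[OF p] by (rule order_trans)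
  have "q (- y) \<le> - p y"
    using le_funD[OF q(2), of "- y"] tilt_le[OF p, of 1 y "- y"] sublinear_zero[OF p] by simp
  then have "q y = p y"
    using le_funD[OF le, of y] linear_neg[OF lin, of y] by simp
  with lin le show ?thesis by (rule that)
qed

section \<open>Topological vector spaces and their products\<close>

lemma tendsto_scaleR_tvs:
  fixes g :: "'b \<Rightarrow> 'a::real_tvs"
  assumes "(f \<longlongrightarrow> c) F" "(g \<longlongrightarrow> x) F"
  shows "((\<lambda>z. f z *\<^sub>R g z) \<longlongrightarrow> c *\<^sub>R x) F"
  using filterlim_compose[OF tendsto_scaleR_Pair filterlim_Pair[OF assms]] by simp

lemma continuous_on_scaleR_tvs:
  fixes g :: "'b::topological_space \<Rightarrow> 'a::real_tvs"
  assumes "continuous_on S f" "continuous_on S g"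
  shows "continuous_on S (\<lambda>z. f z *\<^sub>R g z)"
  using assms unfolding continuous_on_def by (blast intro: tendsto_scaleR_tvs)

text \<open>
  Epigraphs live in \<open>X \<times> \<real>\<close>, so the separation theorem is needed in a product space.
\<close>
instance prod :: (topological_monoid_add, topological_monoid_add) topological_monoid_add
proof
  fix a b :: "'a \<times> 'b"
  have "((\<lambda>p. (fst (fst p) + fst (snd p), snd (fst p) + snd (snd p))) \<longlongrightarrow> (fst a + fst b, snd a + snd b))
      (nhds a \<times>\<^sub>F nhds b)"
    by (intro tendsto_Pair tendsto_add tendsto_fst tendsto_snd filterlim_fst filterlim_snd)
  then show "LIM p (nhds a \<times>\<^sub>F nhds b). fst p + snd p :> nhds (a + b)"
    by (simp add: plus_prod_def)
qed

instance prod :: (topological_group_add, topological_group_add) topological_group_add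
proof
  fix a :: "'a \<times> 'b"
  have "((\<lambda>p. (- fst p, - snd p)) \<longlongrightarrow> (- fst a, - snd a)) (nhds a)"
    by (intro tendsto_Pair tendsto_minus tendsto_fst tendsto_snd filterlim_ident)
  moreover have "uminus = (\<lambda>p::'a \<times> 'b. (- fst p, - snd p))"
    by (simp add: fun_eq_iff uminus_prod_def)
  moreover from this have "- a = (- fst a, - snd a)" by (rule fun_cong)
  ultimately show "(uminus \<longlongrightarrow> - a) (nhds a)" by metis
qed

instance prod :: (topological_ab_group_add, topological_ab_group_add) topological_ab_group_add ..

instance prod :: (real_tvs, real_tvs) real_tvs
proof
  fix c :: real and x :: "'a \<times> 'b"
  have "((\<lambda>p. (fst p *\<^sub>R fst (snd p), fst p *\<^sub>R snd (snd p))) \<longlongrightarrow> (c *\<^sub>R fst x, c *\<^sub>R snd x))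
      (nhds c \<times>\<^sub>F nhds x)"
    by (intro tendsto_Pair tendsto_scaleR_tvs tendsto_fst tendsto_snd filterlim_fst filterlim_snd)
  then show "LIM p (nhds c \<times>\<^sub>F nhds x). fst p *\<^sub>R snd p :> nhds (c *\<^sub>R x)"
    by (simp add: scaleR_prod_def)
qed

instance prod :: (locally_convex_tvs, locally_convex_tvs) locally_convex_tvs
proof
  fix U :: "('a \<times> 'b) set" and x
  assume "open U" "x \<in> U"
  then obtain A B where AB: "open A" "open B" "x \<in> A \<times> B" "A \<times> B \<subseteq> U"
    by (rule open_prod_elim)
  obtain V where V: "open V" "convex V" "fst x \<in> V" "V \<subseteq> A"
    using locally_convex_neighbourhood[OF AB(1), of "fst x"] AB(3) by auto
  obtain W where W: "open W" "convex W" "snd x \<in> W" "W \<subseteq> B"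
    using locally_convex_neighbourhood[OF AB(2), of "snd x"] AB(3) by auto
  have "open (V \<times> W) \<and> convex (V \<times> W) \<and> x \<in> V \<times> W \<and> V \<times> W \<subseteq> U"
    using V W AB(4) by (auto simp: mem_Times_iff intro: open_Times convex_Times)
  then show "\<exists>V. open V \<and>
      (\<forall>a\<in>V. \<forall>b\<in>V. \<forall>u\<ge>0. \<forall>v\<ge>0. u + v = 1 \<longrightarrow> u *\<^sub>R a + v *\<^sub>R b \<in> V) \<and> x \<in> V \<and> V \<subseteq> U"
    unfolding convex_def by blast
qed

section \<open>Separating a point from a convex cone\<close>

lemma absorbing_neighbourhood:
  fixes V :: "'a::real_tvs set"
  assumes "open V" "0 \<in> V"
  obtains t where "t > 0" "(1 / t) *\<^sub>R x \<in> V"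
proof -
  have "((\<lambda>s. s *\<^sub>R x) \<longlongrightarrow> 0 *\<^sub>R x) (at_right 0)"
    by (intro tendsto_scaleR_tvs tendsto_intros)
  then have "eventually (\<lambda>s. s *\<^sub>R x \<in> V) (at_right 0)"
    using assms by (simp add: topological_tendstoD)
  then have "eventually (\<lambda>s. s *\<^sub>R x \<in> V \<and> s > 0) (at_right (0::real))"
    using eventually_at_right_less by (rule eventually_conj)
  then obtain s :: real where "s *\<^sub>R x \<in> V" "s > 0"
    using eventually_happens' trivial_limit_at_right_real by blast
  then show ?thesis by (intro that[of "1 / s"]) auto
qed

text \<open>
  For \<open>y\<close> near \<open>x\<close> both \<open>(2 / e) (y - x)\<close> and \<open>(2 / e) (x - y)\<close> are in \<open>V\<close>; the two one-sided bounds give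
  \<open>\<bar>\<phi> y - \<phi> x\<bar> \<le> e / 2\<close>.
\<close>
lemma linear_bounded_above_imp_continuous:
  fixes \<phi> :: "'a::real_tvs \<Rightarrow> real"
  assumes lin: "linear \<phi>" and V: "open V" "0 \<in> V" and le: "\<And>v. v \<in> V \<Longrightarrow> \<phi> v \<le> 1"
  shows "continuous_on UNIV \<phi>"
proof -
  have "(\<phi> \<longlongrightarrow> \<phi> x) (at x)" for x
  proof (rule tendstoI)
    fix e :: real assume e: "e > 0"
    have "((\<lambda>y. (2 / e) *\<^sub>R (y - x)) \<longlongrightarrow> (2 / e) *\<^sub>R (x - x)) (at x)"
      "((\<lambda>y. (2 / e) *\<^sub>R (x - y)) \<longlongrightarrow> (2 / e) *\<^sub>R (x - x)) (at x)"
      by (intro tendsto_scaleR_tvs tendsto_intros)+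
    then have "eventually (\<lambda>y. (2 / e) *\<^sub>R (y - x) \<in> V) (at x)"
      "eventually (\<lambda>y. (2 / e) *\<^sub>R (x - y) \<in> V) (at x)"
      using V by (simp_all add: topological_tendstoD)
    then show "eventually (\<lambda>y. dist (\<phi> y) (\<phi> x) < e) (at x)"
    proof eventually_elim
      case (elim y)
      have "(2 / e) * (\<phi> y - \<phi> x) \<le> 1" "(2 / e) * (\<phi> x - \<phi> y) \<le> 1"
        using le[OF elim(1)] le[OF elim(2)] by (simp_all add: linear_scale[OF lin] linear_diff[OF lin])
      with e show ?case by (simp add: dist_real_def abs_less_iff field_simps)
    qed
  qed
  then show ?thesis unfolding continuous_on_def by simp
qed

text \<open>
  The Minkowski gauge of \<open>V + C\<close> for a cone \<open>C\<close>, as \<open>x \<in> t (V + C)\<close> means \<open>(x - c) / t \<in> V\<close> for some \<open>c \<in> C\<close>.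
  It is at most \<open>0\<close> on \<open>C\<close> and at most \<open>1\<close> on \<open>V\<close>, so a linear functional below it is automatically
  nonpositive on \<open>C\<close> and continuous.
\<close>
definition cone_gauge :: "'a::real_vector set \<Rightarrow> 'a set \<Rightarrow> 'a \<Rightarrow> real" where
  "cone_gauge V C x = Inf {t. t > 0 \<and> (\<exists>c\<in>C. (1 / t) *\<^sub>R (x - c) \<in> V)}"

lemma cone_gauge_le:
  assumes "t > 0" "c \<in> C" "(1 / t) *\<^sub>R (x - c) \<in> V"
  shows "cone_gauge V C x \<le> t"
  unfolding cone_gauge_def
  by (rule cInf_lower) (use assms in \<open>auto intro: bdd_belowI[of _ 0]\<close>)

lemma cone_gauge_greatest:
  fixes V :: "'a::real_tvs set"
  assumes V: "open V" "0 \<in> V" and C: "convex_cone C"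
    and m: "\<And>t c. t > 0 \<Longrightarrow> c \<in> C \<Longrightarrow> (1 / t) *\<^sub>R (x - c) \<in> V \<Longrightarrow> m \<le> t"
  shows "m \<le> cone_gauge V C x"
  unfolding cone_gauge_def
proof (rule cInf_greatest)
  obtain t where "t > 0" "(1 / t) *\<^sub>R x \<in> V"
    using absorbing_neighbourhood[OF V] .
  moreover have "0 \<in> C" using C by (simp add: convex_cone_iff)
  ultimately have "t \<in> {t. t > 0 \<and> (\<exists>c\<in>C. (1 / t) *\<^sub>R (x - c) \<in> V)}"
    by (auto intro!: bexI[of _ 0])
  then show "{t. t > 0 \<and> (\<exists>c\<in>C. (1 / t) *\<^sub>R (x - c) \<in> V)} \<noteq> {}" by blast
qed (use m in auto)

lemma sublinear_cone_gauge:
  fixes V :: "'a::real_tvs set"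
  assumes V: "open V" "0 \<in> V" "convex V" and C: "convex_cone C"
  shows "sublinear (cone_gauge V C)"
proof (rule sublinearI)
  let ?p = "cone_gauge V C"
  fix x y
  have "?p (x + y) \<le> t + s"
    if t: "t > 0" "c \<in> C" "(1 / t) *\<^sub>R (x - c) \<in> V"
      and s: "s > 0" "d \<in> C" "(1 / s) *\<^sub>R (y - d) \<in> V" for t s c d
  proof (rule cone_gauge_le)
    show "c + d \<in> C" using C t(2) s(2) by (rule convex_cone_add)
    \<comment> \<open>The weights \<open>t / (t + s)\<close> and \<open>s / (t + s)\<close> make the two rescaled differences combine with
      the single factor \<open>1 / (t + s)\<close>.\<close>
    have "(t / (t + s)) *\<^sub>R (1 / t) *\<^sub>R (x - c) + (s / (t + s)) *\<^sub>R (1 / s) *\<^sub>R (y - d) \<in> V"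
      by (rule convexD[OF V(3) t(3) s(3)])
        (use t s in \<open>simp_all add: add_divide_distrib[symmetric]\<close>)
    also have "(t / (t + s)) *\<^sub>R (1 / t) *\<^sub>R (x - c) + (s / (t + s)) *\<^sub>R (1 / s) *\<^sub>R (y - d)
        = (1 / (t + s)) *\<^sub>R (x + y - (c + d))"
      using t(1) s(1) by (simp add: algebra_simps)
    finally show "(1 / (t + s)) *\<^sub>R (x + y - (c + d)) \<in> V" .
  qed (use t s in simp)
  then have "?p (x + y) - t \<le> ?p y" if "t > 0" "c \<in> C" "(1 / t) *\<^sub>R (x - c) \<in> V" for t c
    using that by (intro cone_gauge_greatest[OF V(1,2) C]) (fastforce simp: algebra_simps)
  then have "?p (x + y) - ?p y \<le> ?p x"
    by (intro cone_gauge_greatest[OF V(1,2) C]) (fastforce simp: algebra_simps)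
  then show "?p (x + y) \<le> ?p x + ?p y" by simp
next
  let ?p = "cone_gauge V C"
  fix t :: real and x assume t: "t > 0"
  have "?p (t *\<^sub>R x) / t \<le> ?p x"
  proof (rule cone_gauge_greatest[OF V(1,2) C])
    fix s c assume s: "s > 0" "c \<in> C" "(1 / s) *\<^sub>R (x - c) \<in> V"
    have "?p (t *\<^sub>R x) \<le> t * s"
    proof (rule cone_gauge_le)
      show "t *\<^sub>R c \<in> C" using C s(2) t by (simp add: convex_cone_scaleR)
      show "(1 / (t * s)) *\<^sub>R (t *\<^sub>R x - t *\<^sub>R c) \<in> V"
        using s t by (simp flip: scaleR_diff_right)
    qed (use s t in simp)
    with t show "?p (t *\<^sub>R x) / t \<le> s" by (simp add: field_simps)
  qed
  with t show "?p (t *\<^sub>R x) \<le> t * ?p x" by (simp add: field_simps)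
qed

text \<open>
  If \<open>z - V\<close> misses the closure of \<open>C\<close>, then \<open>z\<close> is outside \<open>V + C\<close> and its gauge is at least \<open>1\<close>. A linear
  functional below the gauge that agrees with it at \<open>z\<close> is positive there; its negative separates.
\<close>
theorem separate_point_convex_cone:
  fixes C :: "'a::locally_convex_tvs set"
  assumes C: "convex_cone C" and z: "z \<notin> closure C"
  obtains \<phi> where "\<phi> \<in> topological_dual" "\<And>c. c \<in> C \<Longrightarrow> 0 \<le> \<phi> c" "\<phi> z < 0"
proof -
  have zero: "0 \<in> C" using C by (simp add: convex_cone_iff)
  have "open ((\<lambda>v. z - v) -` (- closure C))"
    by (intro open_vimage continuous_intros) auto
  moreover have "0 \<in> (\<lambda>v. z - v) -` (- closure C)" using z by simp
  ultimately obtain V where V: "open V" "convex V" "0 \<in> V" and Vz: "V \<subseteq> (\<lambda>v. z - v) -` (- closure C)"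
    using locally_convex_neighbourhood by metis
  let ?p = "cone_gauge V C"
  obtain \<phi> where lin: "linear \<phi>" and le: "\<phi> \<le> ?p" and at_z: "\<phi> z = ?p z"
    using Hahn_Banach_sublinear[OF sublinear_cone_gauge[OF V(1,3,2) C]] by metis
  have on_C: "\<phi> c \<le> 0" if "c \<in> C" for c
  proof (rule field_le_epsilon)
    fix e :: real assume "e > 0"
    then have "?p c \<le> e"
      using that V(3) by (intro cone_gauge_le[of e c]) auto
    then show "\<phi> c \<le> 0 + e" using le_funD[OF le, of c] by simp
  qed
  have on_V: "\<phi> v \<le> 1" if "v \<in> V" for v
  proof -
    have "?p v \<le> 1" using that zero by (intro cone_gauge_le[of 1 0]) auto
    then show ?thesis using le_funD[OF le, of v] by simp
  qed
  have "1 \<le> ?p z"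
  proof (rule cone_gauge_greatest[OF V(1,3) C], rule ccontr)
    fix t c assume t: "t > 0" "c \<in> C" "(1 / t) *\<^sub>R (z - c) \<in> V" "\<not> 1 \<le> t"
    have "t *\<^sub>R (1 / t) *\<^sub>R (z - c) + (1 - t) *\<^sub>R 0 \<in> V"
      by (rule convexD[OF V(2) t(3) V(3)]) (use t in auto)
    then have "z - c \<in> V" using t(1) by simp
    then have "c \<notin> closure C" using Vz by auto
    with t(2) show False using closure_subset by blast
  qed
  then have "\<phi> z > 0" using at_z by simp
  moreover have "(\<lambda>x. - \<phi> x) \<in> topological_dual"
    using linear_compose_neg[OF lin]
      continuous_on_minus[OF linear_bounded_above_imp_continuous[OF lin V(1,3) on_V]]
    by (simp add: topological_dual_def)
  ultimately show ?thesis
    using on_C by (intro that[of "\<lambda>x. - \<phi> x"]) auto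
qed

section \<open>Quasi-relative interior and supporting functionals\<close>

lemma subspace_closure_convex_cone:
  fixes C :: "'a::real_tvs set"
  assumes C: "convex_cone C" and neg: "\<And>c. c \<in> C \<Longrightarrow> - c \<in> closure C"
  shows "subspace (closure C)"
proof -
  have sub: "C \<subseteq> closure C" by (rule closure_subset)
  have zero: "0 \<in> closure C"
    using C sub by (auto simp: convex_cone_iff)
  have "(\<lambda>p. fst p + snd p) ` closure (C \<times> C) \<subseteq> closure C"
  proof (rule image_closure_subset)
    show "(\<lambda>p. fst p + snd p) ` (C \<times> C) \<subseteq> closure C"
      using C sub by (auto simp: convex_cone_iff)
  qed (intro continuous_intros closed_closure)+
  then have add: "x + y \<in> closure C" if "x \<in> closure C" "y \<in> closure C" for x y
    using that by (force simp: closure_Times)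
  have scale: "c *\<^sub>R x \<in> closure C" if c: "c \<ge> 0" and x: "x \<in> closure C" for c x
  proof -
    have "(\<lambda>x. c *\<^sub>R x) ` closure C \<subseteq> closure C"
    proof (rule image_closure_subset)
      show "(\<lambda>x. c *\<^sub>R x) ` C \<subseteq> closure C"
        using C sub c by (auto simp: convex_cone_iff)
    qed (intro continuous_on_scaleR_tvs continuous_intros closed_closure)+
    with x show ?thesis by blast
  qed
  have "uminus ` closure C \<subseteq> closure C"
    by (intro image_closure_subset continuous_intros closed_closure) (use neg in auto)
  then have minus: "- x \<in> closure C" if "x \<in> closure C" for x
    using that by blast
  have "c *\<^sub>R x \<in> closure C" if "x \<in> closure C" for c x
    using scale[of c x] scale[of "- c" "- x"] minus[OF that] that by (cases "c \<ge> 0") auto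
  with zero add show ?thesis by (simp add: subspace_def)
qed

lemma minkowski_diffI: "a \<in> A \<Longrightarrow> b \<in> B \<Longrightarrow> x = a - b \<Longrightarrow> x \<in> minkowski_diff A B"
  unfolding minkowski_diff_def by blast

lemma convex_minkowski_diff: "convex A \<Longrightarrow> convex B \<Longrightarrow> convex (minkowski_diff A B)"
  using convex_differences[of A B] unfolding minkowski_diff_def
  by (rule back_subst[of convex]) auto

lemma diff_in_cone_generated: "w \<in> \<Omega> \<Longrightarrow> w - x \<in> cone_generated (minkowski_diff \<Omega> {x})"
  unfolding cone_generated_def minkowski_diff_def by (auto intro!: exI[of _ 1])

lemma convex_cone_cone_generated:
  assumes "convex S" "S \<noteq> {}"
  shows "convex_cone (cone_generated S)"
proof -
  have "cone_generated S = conic hull S"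
    by (auto simp: cone_generated_def conic_hull_explicit)
  then show ?thesis
    using assms by (simp add: convex_cone_def conic_conic_hull convex_conic_hull conic_hull_eq_empty)
qed

text \<open>
  The functional is nonnegative on the cone generated by \<open>\<Omega> - x\<close>, hence by continuity on its closure; on a subspace a nonnegative linear functional vanishes.
\<close>
lemma functional_constant_if_minimal_at_qri:
  assumes x: "x \<in> qri \<Omega>" and \<phi>: "\<phi> \<in> topological_dual"
    and min: "\<And>w. w \<in> \<Omega> \<Longrightarrow> \<phi> x \<le> \<phi> w" and w: "w \<in> \<Omega>"
  shows "\<phi> w = \<phi> x"
proof -
  define K where "K = closure (cone_generated (minkowski_diff \<Omega> {x}))"
  have sub: "subspace K" using x by (simp add: qri_def K_def)
  have lin: "linear \<phi>" and cont: "continuous_on UNIV \<phi>"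
    using \<phi> by (auto simp: topological_dual_def)
  have "\<phi> ` K \<subseteq> {0..}"
    unfolding K_def
  proof (rule image_closure_subset)
    show "\<phi> ` cone_generated (minkowski_diff \<Omega> {x}) \<subseteq> {0..}"
      using min by (auto simp: cone_generated_def minkowski_diff_def
          linear_scale[OF lin] linear_diff[OF lin])
  qed (use cont continuous_on_subset in auto)
  moreover have "w - x \<in> K"
    unfolding K_def using diff_in_cone_generated[OF w] closure_subset by blast
  moreover from this have "- (w - x) \<in> K" by (rule subspace_neg[OF sub])
  ultimately have "0 \<le> \<phi> (w - x)" "0 \<le> \<phi> (- (w - x))" by blast+
  then show ?thesis by (simp add: linear_neg[OF lin] linear_diff[OF lin])
qed

text \<open>
  The converse for convex sets: if the closed cone at \<open>x\<close> is not a subspace, then some element \<open>c\<close> of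
  the cone itself has \<open>- c\<close> outside the closure. A functional that separates \<open>- c\<close> from the cone is
  positive at \<open>c\<close>, so it is not constant on the set.
\<close>
lemma supporting_functional_outside_qri:
  fixes \<Omega> :: "'a::locally_convex_tvs set"
  assumes "convex \<Omega>" and x: "x \<in> \<Omega>" "x \<notin> qri \<Omega>"
  obtains \<phi> u where "\<phi> \<in> topological_dual" "\<And>w. w \<in> \<Omega> \<Longrightarrow> \<phi> x \<le> \<phi> w" "u \<in> \<Omega>" "\<phi> x < \<phi> u"
proof -
  define C where "C = cone_generated (minkowski_diff \<Omega> {x})"
  have C: "convex_cone C"
    unfolding C_def using assms(1) x(1)
    by (intro convex_cone_cone_generated convex_minkowski_diff) (auto simp: minkowski_diff_def)
  have "\<not> subspace (closure C)"
    using x by (simp add: qri_def C_def)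
  then obtain c where c: "c \<in> C" "- c \<notin> closure C"
    using subspace_closure_convex_cone[OF C] by blast
  obtain \<phi> where \<phi>: "\<phi> \<in> topological_dual" "\<And>c. c \<in> C \<Longrightarrow> 0 \<le> \<phi> c" "\<phi> (- c) < 0"
    using separate_point_convex_cone[OF C c(2)] by metis
  have lin: "linear \<phi>" using \<phi>(1) by (simp add: topological_dual_def)
  obtain t u where u: "u \<in> \<Omega>" "t \<ge> 0" "c = t *\<^sub>R (u - x)"
    using c(1) unfolding C_def cone_generated_def minkowski_diff_def by auto
  have "\<phi> x \<le> \<phi> w" if "w \<in> \<Omega>" for w
    using \<phi>(2)[of "w - x"] diff_in_cone_generated[OF that] by (simp add: C_def linear_diff[OF lin])
  moreover have "0 < t * (\<phi> u - \<phi> x)"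
    using \<phi>(3) u(3) by (simp add: linear_neg[OF lin] linear_scale[OF lin] linear_diff[OF lin])
  then have "\<phi> x < \<phi> u"
    using u(2) by (simp add: zero_less_mult_iff)
  ultimately show ?thesis using \<phi>(1) u(1) by (intro that)
qed

section \<open>Fenchel duality\<close>

lemma convex_hypo:
  assumes "convex (epi (\<lambda>x. - g x))"
  shows "convex (hypo g)"
proof -
  have "linear (\<lambda>p::'a \<times> real. (fst p, - snd p))"
    by (intro linearI) auto
  moreover have "hypo g = (\<lambda>p. (fst p, - snd p)) -` epi (\<lambda>x. - g x)"
  proof (rule set_eqI)
    fix p :: "'a \<times> real"
    show "p \<in> hypo g \<longleftrightarrow> p \<in> (\<lambda>p. (fst p, - snd p)) -` epi (\<lambda>x. - g x)"
      by (cases p; cases "g (fst p)") (auto simp: hypo_def epi_def)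
  qed
  ultimately show ?thesis
    using assms by (simp add: convex_linear_vimage)
qed

lemma weak_duality:
  assumes "f x \<noteq> - \<infinity>" "g x \<noteq> \<infinity>"
  shows "concave_conjugate g \<phi> - convex_conjugate f \<phi> \<le> f x - g x"
proof -
  have "concave_conjugate g \<phi> \<le> ereal (\<phi> x) - g x"
    unfolding concave_conjugate_def by (rule INF_lower) simp
  moreover have "ereal (\<phi> x) - f x \<le> convex_conjugate f \<phi>"
    unfolding convex_conjugate_def by (rule SUP_upper) simp
  ultimately have "concave_conjugate g \<phi> - convex_conjugate f \<phi>
      \<le> (ereal (\<phi> x) - g x) - (ereal (\<phi> x) - f x)"
    by (rule ereal_minus_mono)
  also have "\<dots> = f x - g x"
    using assms by (cases "f x"; cases "g x") auto
  finally show ?thesis .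
qed

lemma epi_minus_hypo_upward:
  assumes "(z, m) \<in> minkowski_diff (epi f) (hypo g)" "m \<le> n"
  shows "(z, n) \<in> minkowski_diff (epi f) (hypo g)"
proof -
  obtain x y a b where "f x \<le> ereal a" "ereal b \<le> g y" "z = x - y" "m = a - b"
    using assms(1) by (auto simp: minkowski_diff_def epi_def hypo_def)
  moreover have "f x \<le> ereal (a + (n - m))"
    using \<open>f x \<le> ereal a\<close> by (rule order_trans) (use assms(2) in simp)
  ultimately show ?thesis
    by (intro minkowski_diffI[of "(x, a + (n - m))" _ "(y, b)"]) (auto simp: epi_def hypo_def)
qed

text \<open>
  If the cone generated by \<open>M - (0, m)\<close> were a subspace, it would contain \<open>(0, -1)\<close> along with \<open>(0, 1)\<close>.
  Then \<open>M\<close> would have a point on the vertical axis below \<open>m\<close>, and with it a pair \<open>a \<ge> f y\<close>,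
  \<open>b \<le> g y\<close> with \<open>a - b < m\<close>, against the lower bound on \<open>f - g\<close>.
\<close>
lemma zero_not_in_iri_epi_minus_hypo:
  assumes min: "\<And>x. ereal m \<le> f x - g x"
  shows "(0, m) \<notin> iri (minkowski_diff (epi f) (hypo g))"
proof
  let ?M = "minkowski_diff (epi f) (hypo g)"
  let ?K = "cone_generated (minkowski_diff ?M {(0, m)})"
  assume iri: "(0, m) \<in> iri ?M"
  then have sub: "subspace ?K" and "(0, m) \<in> ?M"
    by (auto simp: iri_def)
  from this(2) have "(0, m + 1) \<in> ?M"
    by (rule epi_minus_hypo_upward) simp
  then have "(0, m + 1) - (0, m) \<in> ?K"
    by (rule diff_in_cone_generated)
  then have "(0, 1) \<in> ?K" by simp
  then have "- (0, 1) \<in> ?K" by (rule subspace_neg[OF sub])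
  then obtain t y z a b where t: "t \<ge> 0" "f y \<le> ereal a" "ereal b \<le> g z"
      and eq: "- (0, 1) = t *\<^sub>R ((y, a) - (z, b) - (0, m))"
    by (auto simp: cone_generated_def minkowski_diff_def epi_def hypo_def)
  from eq have eqs: "t *\<^sub>R (y - z) = 0" "t * (a - b - m) = -1" by auto
  then have "t \<noteq> 0" by auto
  then have "y = z" using eqs by simp
  have "f y - g y \<le> ereal a - ereal b"
    using t(2,3) \<open>y = z\<close> by (intro ereal_minus_mono) auto
  with min[of y] have "ereal m \<le> ereal a - ereal b" by (rule order_trans)
  then have "m \<le> a - b" by simp
  then have "0 \<le> t * (a - b - m)" using t(1) by simp
  with eqs(2) show False by simp
qed

lemma point_of_epi_minus_hypo:
  assumes "f x = ereal a" "g y = ereal b"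
  shows "(x - y, a - b) \<in> minkowski_diff (epi f) (hypo g)"
  using assms by (intro minkowski_diffI[of "(x, a)" _ "(y, b)"]) (auto simp: epi_def hypo_def)

lemma topological_dual_prod:
  fixes \<psi> :: "'a::real_tvs \<times> real \<Rightarrow> real"
  assumes "\<psi> \<in> topological_dual"
  shows "(\<lambda>x. c * \<psi> (x, 0)) \<in> topological_dual" and "\<psi> (x, a) = \<psi> (x, 0) + a * \<psi> (0, 1)"
proof -
  have lin: "linear \<psi>" and cont: "continuous_on UNIV \<psi>"
    using assms by (auto simp: topological_dual_def)
  have "linear (\<lambda>x. c * \<psi> (x, 0))"
  proof (rule linearI)
    show "c * \<psi> (x + y, 0) = c * \<psi> (x, 0) + c * \<psi> (y, 0)" for x y
      using linear_add[OF lin, of "(x, 0)" "(y, 0)"] by (simp add: distrib_left)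
    show "c * \<psi> (r *\<^sub>R x, 0) = r *\<^sub>R (c * \<psi> (x, 0))" for r x
      using linear_scale[OF lin, of r "(x, 0)"] by simp
  qed
  moreover have "continuous_on UNIV (\<lambda>x. c * \<psi> (x, 0))"
    by (intro continuous_intros continuous_on_compose2[OF cont]) auto
  ultimately show "(\<lambda>x. c * \<psi> (x, 0)) \<in> topological_dual"
    by (simp add: topological_dual_def)
  show "\<psi> (x, a) = \<psi> (x, 0) + a * \<psi> (0, 1)"
    using linear_add[OF lin, of "(x, 0)" "(0, a)"] linear_scale[OF lin, of a "(0, 1)"] by simp
qed

text \<open>
  This is where the common point of the quasi-relative interiors enters: it excludes a vertical
  supporting hyperplane. Were \<open>\<psi> (0, 1)\<close> zero, \<open>\<psi> (0, m)\<close> would vanish and the support inequality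
  would read \<open>\<rho> y \<le> \<rho> x\<close> for \<open>x\<close> in the domain of \<open>f\<close> and \<open>y\<close> in that of \<open>g\<close>. At \<open>x0\<close>, \<open>\<rho>\<close> is then minimal over
  the first set and \<open>- \<rho>\<close> over the second, so \<open>\<rho>\<close> equals \<open>\<rho> x0\<close> on both.
\<close>
lemma nonvertical_supporting_functional:
  fixes f g :: "'a::real_tvs \<Rightarrow> ereal"
  assumes finite: "\<And>x. f x \<noteq> - \<infinity>" "\<And>x. g x \<noteq> \<infinity>"
    and x0: "x0 \<in> qri (dom_convex f)" "x0 \<in> qri (dom_concave g)"
    and \<psi>: "\<psi> \<in> topological_dual"
    and m: "(0, m) \<in> minkowski_diff (epi f) (hypo g)"
    and min: "\<And>w. w \<in> minkowski_diff (epi f) (hypo g) \<Longrightarrow> \<psi> (0, m) \<le> \<psi> w"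
    and u: "u \<in> minkowski_diff (epi f) (hypo g)" "\<psi> (0, m) < \<psi> u"
  shows "0 < \<psi> (0, 1)"
proof -
  define \<rho> where "\<rho> = (\<lambda>x. \<psi> (x, 0))"
  have \<rho>: "\<rho> \<in> topological_dual" "(\<lambda>x. - \<rho> x) \<in> topological_dual"
    using topological_dual_prod(1)[OF \<psi>, of 1] topological_dual_prod(1)[OF \<psi>, of "- 1"]
    by (simp_all add: \<rho>_def)
  have lin: "linear \<rho>" using \<rho>(1) by (simp add: topological_dual_def)
  have split: "\<psi> (x, a) = \<rho> x + a * \<psi> (0, 1)" for x a
    unfolding \<rho>_def by (rule topological_dual_prod(2)[OF \<psi>])
  have "(0, m + 1) \<in> minkowski_diff (epi f) (hypo g)"
    using m by (rule epi_minus_hypo_upward) simp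
  then have "0 \<le> \<psi> (0, 1)"
    using min[of "(0, m + 1)"] split[of 0 m] split[of 0 "m + 1"] by (simp add: distrib_right)
  moreover have "\<psi> (0, 1) \<noteq> 0"
  proof
    assume vertical: "\<psi> (0, 1) = 0"
    have le: "\<rho> y \<le> \<rho> x" if "x \<in> dom_convex f" "y \<in> dom_concave g" for x y
    proof -
      have "f x < \<infinity>" "- \<infinity> < g y"
        using that by (auto simp: dom_convex_def dom_concave_def)
      then obtain a b where "f x = ereal a" "g y = ereal b"
        using finite(1)[of x] finite(2)[of y] by (cases "f x"; cases "g y") auto
      then have "(x - y, a - b) \<in> minkowski_diff (epi f) (hypo g)"
        by (rule point_of_epi_minus_hypo)
      then have "\<psi> (0, m) \<le> \<psi> (x - y, a - b)" by (rule min)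
      then show ?thesis
        using split[of 0 m] split[of "x - y" "a - b"] linear_0[OF lin] vertical
        by (simp add: linear_diff[OF lin])
    qed
    have dom: "x0 \<in> dom_convex f" "x0 \<in> dom_concave g"
      using x0 by (auto simp: qri_def)
    have on_f: "\<rho> x = \<rho> x0" if "x \<in> dom_convex f" for x
      by (rule functional_constant_if_minimal_at_qri[OF x0(1) \<rho>(1) _ that]) (rule le[OF _ dom(2)])
    have on_g: "\<rho> y = \<rho> x0" if "y \<in> dom_concave g" for y
    proof -
      have "- \<rho> y = - \<rho> x0"
        by (rule functional_constant_if_minimal_at_qri[OF x0(2) \<rho>(2) _ that])
          (use le[OF dom(1)] in simp)
      then show ?thesis by simp
    qed
    obtain x y a b where xy: "u = (x - y, a - b)" "f x \<le> ereal a" "ereal b \<le> g y"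
      using u(1) by (auto simp: minkowski_diff_def epi_def hypo_def)
    then have "x \<in> dom_convex f" "y \<in> dom_concave g"
      by (auto simp: dom_convex_def dom_concave_def)
    then have "\<rho> (x - y) = 0"
      using on_f on_g by (simp add: linear_diff[OF lin])
    then show False
      using u(2) split[of 0 m] split[of "x - y" "a - b"] linear_0[OF lin] vertical xy(1) by simp
  qed
  ultimately show ?thesis by simp
qed

text \<open>
  The inequality is assumed at points of finite value only, where it is one between real numbers;
  at the other points one of the two sides is infinite in the favourable direction. Finiteness of \<open>f\<close>
  and \<open>g\<close> somewhere prevents \<open>\<infinity> - \<infinity>\<close> in the difference of the conjugates.
\<close>
lemma dual_bound_from_separation:
  assumes sep: "\<And>x y a b. f x = ereal a \<Longrightarrow> g y = ereal b \<Longrightarrow> \<phi> x - a + m \<le> \<phi> y - b"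
    and finite: "\<And>x. f x \<noteq> - \<infinity>" "\<And>x. g x \<noteq> \<infinity>" "f x0 \<noteq> \<infinity>" "g y0 \<noteq> - \<infinity>"
  shows "ereal m \<le> concave_conjugate g \<phi> - convex_conjugate f \<phi>"
proof -
  have le: "ereal (\<phi> x) - f x + ereal m \<le> ereal (\<phi> y) - g y" for x y
    using finite(1)[of x] finite(2)[of y] sep[of x _ y]
    by (cases "f x"; cases "g y") auto
  have "ereal (\<phi> x) - f x + ereal m \<le> concave_conjugate g \<phi>" for x
    unfolding concave_conjugate_def using le by (intro INF_greatest)
  then have "ereal (\<phi> x) - f x \<le> concave_conjugate g \<phi> - ereal m" for x
    by (simp add: ereal_le_minus)
  then have conj_le: "convex_conjugate f \<phi> \<le> concave_conjugate g \<phi> - ereal m"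
    unfolding convex_conjugate_def by (intro SUP_least)
  have "concave_conjugate g \<phi> \<le> ereal (\<phi> y0) - g y0"
    unfolding concave_conjugate_def by (rule INF_lower) simp
  then have "concave_conjugate g \<phi> \<noteq> \<infinity>"
    using finite(2)[of y0] finite(4) by (cases "g y0") auto
  moreover have "ereal (\<phi> x0) - f x0 \<le> convex_conjugate f \<phi>"
    unfolding convex_conjugate_def by (rule SUP_upper) simp
  then have "convex_conjugate f \<phi> \<noteq> - \<infinity>"
    using finite(1)[of x0] finite(3) by (cases "f x0") auto
  ultimately show ?thesis
    using conj_le by (cases "concave_conjugate g \<phi>"; cases "convex_conjugate f \<phi>") auto
qed

theorem theorem4p6:
  fixes f g :: "'a::locally_convex_tvs \<Rightarrow> ereal"
  assumes "proper_convex f"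
    and "proper_concave g"
    and "\<exists>xh. (INF x. f x - g x) = f xh - g xh"
    and "qri (dom_convex f) \<inter> qri (dom_concave g) \<noteq> {}"
    and "quasi_regular (minkowski_diff (dom_convex f) (dom_concave g))"
    and "quasi_regular (epi f)"
    and "quasi_regular (minkowski_diff (epi f) (hypo g))"
  shows "(INF x. f x - g x) =
    (SUP \<phi>\<in>topological_dual. concave_conjugate g \<phi> - convex_conjugate f \<phi>)"
proof (rule antisym)
  let ?M = "minkowski_diff (epi f) (hypo g)"
  have finite: "f x \<noteq> - \<infinity>" "g x \<noteq> \<infinity>" for x
    using assms(1,2) by (auto simp: proper_concave_def proper_convex_def dest: spec[of _ x])
  show "(SUP \<phi>\<in>topological_dual. concave_conjugate g \<phi> - convex_conjugate f \<phi>) \<le> (INF x. f x - g x)"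
    by (intro SUP_least INF_greatest weak_duality finite)

  obtain x0 where x0: "x0 \<in> qri (dom_convex f)" "x0 \<in> qri (dom_concave g)"
    using assms(4) by blast
  then have dom: "f x0 \<noteq> \<infinity>" "g x0 \<noteq> - \<infinity>"
    by (auto simp: qri_def dom_convex_def dom_concave_def)
  obtain xh where xh: "(INF x. f x - g x) = f xh - g xh"
    using assms(3) by blast
  have inf_le: "f xh - g xh \<le> f x - g x" for x
    unfolding xh[symmetric] by (rule INF_lower) simp
  \<comment> \<open>Neither \<open>f xh\<close> nor \<open>- g xh\<close> is \<open>- \<infinity>\<close>, and their sum is at most the finite value at \<open>x0\<close>.\<close>
  obtain a b where ab: "f xh = ereal a" "g xh = ereal b"
    using inf_le[of x0] finite[of xh] finite[of x0] dom
    by (cases "f xh"; cases "g xh"; cases "f x0"; cases "g x0") auto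
  define m where "m = a - b"
  have inf_eq: "(INF x. f x - g x) = ereal m"
    using xh ab by (simp add: m_def)
  have mM: "(0, m) \<in> ?M"
    using point_of_epi_minus_hypo[of f xh a g xh b] ab by (simp add: m_def)
  have "(0, m) \<notin> iri ?M"
    using inf_le ab by (intro zero_not_in_iri_epi_minus_hypo) (simp add: m_def)
  then have "(0, m) \<notin> qri ?M"
    using assms(7) by (simp add: quasi_regular_def)
  moreover have "convex ?M"
    using assms(1,2) by (intro convex_minkowski_diff convex_hypo)
      (auto simp: proper_concave_def proper_convex_def)
  ultimately obtain \<psi> u where \<psi>: "\<psi> \<in> topological_dual" "\<And>w. w \<in> ?M \<Longrightarrow> \<psi> (0, m) \<le> \<psi> w"
      "u \<in> ?M" "\<psi> (0, m) < \<psi> u"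
    using supporting_functional_outside_qri mM by metis
  have pos: "0 < \<psi> (0, 1)"
    by (rule nonvertical_supporting_functional[OF finite x0 \<psi>(1) mM \<psi>(2-4)])
  define \<phi> where "\<phi> = (\<lambda>x. - (1 / \<psi> (0, 1)) * \<psi> (x, 0))"
  have dual: "\<phi> \<in> topological_dual"
    unfolding \<phi>_def by (rule topological_dual_prod(1)[OF \<psi>(1)])
  have lin: "linear \<phi>" using dual by (simp add: topological_dual_def)
  have \<psi>_eq: "\<psi> (x, r) = \<psi> (0, 1) * (r - \<phi> x)" for x r
    using topological_dual_prod(2)[OF \<psi>(1), of x r] pos by (simp add: \<phi>_def field_simps)
  have sep: "\<phi> x - r + m \<le> \<phi> y - s" if "f x = ereal r" "g y = ereal s" for x y r s
  proof -
    have "\<psi> (0, m) \<le> \<psi> (x - y, r - s)"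
      by (rule \<psi>(2)[OF point_of_epi_minus_hypo]) (use that in auto)
    then show ?thesis
      using pos \<psi>_eq[of 0 m] \<psi>_eq[of "x - y" "r - s"]
      by (simp add: linear_0[OF lin] linear_diff[OF lin])
  qed
  have "ereal m \<le> concave_conjugate g \<phi> - convex_conjugate f \<phi>"
    using sep finite dom by (rule dual_bound_from_separation)
  then show "(INF x. f x - g x) \<le> (SUP \<phi>\<in>topological_dual. concave_conjugate g \<phi> - convex_conjugate f \<phi>)"
    unfolding inf_eq by (rule SUP_upper2[OF dual])
qed

end
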